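(* Let $1<p<\infty$, and let $w$ be a non-negative function on $(0,\infty)$. If $w\in B_p$ and $w$ is increasing, then there is a finite constant $C_6$ such that $$x\bigg(\int_0^x w\bigg)^{-1/p}\le\bigg(\int_0^x w^{1-p'}\bigg)^{1/p'}\le C_6\,x\bigg(\int_0^x w\bigg)^{-1/p}$$ for all $x>0$.
   Context: Conjugate indices: $1/p+1/p'=1$. A non-negative function $f$ on $(0,\infty)$ is in $B_p$ if there exists a constant $\beta<\infty$ such that $y^p\int_y^\infty f(x)\,\frac{dx}{x^p}\le\beta\int_0^y f(x)\,dx$ for all $y>0$. "Increasing" means non-decreasing. Usual conventions: negative powers of $0$ are $\infty$ and negative powers of $\infty$ are $0$. *)

theory Defs
  imports "HOL-Analysis.Analysis"
begin

(* Real powers on [0,\<infinity>]: negative powers of 0 are \<infinity> and negative powers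
   of \<infinity> are 0. (Note that 0 powr a = 0 on the reals for every a.) *)
definition ennreal_rpow :: "ennreal \<Rightarrow> real \<Rightarrow> ennreal" where
  "ennreal_rpow x a =
     (if a = 0 then 1
      else if x = 0 then (if a < 0 then \<infinity> else 0)
      else if x = \<infinity> then (if a < 0 then 0 else \<infinity>)
      else ennreal (enn2real x powr a))"

(* A non-negative function on (0,\<infinity>) is a [0,\<infinity>]-valued function of which only
   the values at positive reals matter. Measurability is not imposed: it is
   automatic for monotone functions. *)
definition B_class :: "real \<Rightarrow> (real \<Rightarrow> ennreal) set" where
  "B_class p = {f. \<exists>\<beta>::ennreal. \<beta> < \<infinity> \<and> (\<forall>y>0.
     ennreal (y powr p) * (\<integral>\<^sup>+x\<in>{y<..}. (f x / ennreal (x powr p)) \<partial>lborel)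
       \<le> \<beta> * (\<integral>\<^sup>+x\<in>{0<..<y}. f x \<partial>lborel))}"

end

theory Submission
  imports Defs
begin

text \<open>
  Since \<open>w\<close> is increasing, either \<open>w = 0\<close> or \<open>w = \<infinity>\<close> on all of \<open>(0,\<infinity>)\<close>, or \<open>w\<close> takes values
  \<open>u \<in> (0,\<infinity>)\<close> only. In the last case let \<open>W y\<close> be the integral of \<open>u\<close> over \<open>(0,y)\<close> and \<open>T y\<close> that
  of \<open>u t / t\<^sup>p\<close> over \<open>(y,\<infinity>)\<close>. Monotonicity gives \<open>W y \<le> y u(y)\<close>, so \<open>B\<^sub>p\<close>, with constant \<open>b\<close>, bounds \<open>T y\<close> by a multiple of
  \<open>y u(y) / (2y)\<^sup>p \<le> T y - T (2y)\<close>. Hence \<open>T (2y) \<le> q T y\<close> with \<open>q < 1\<close>: going down the dyadic points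
  \<open>y = x / 2\<^sup>n\<close>, \<open>T y\<close> grows geometrically, and so the terms
  \<open>y * u y powr (1 - p')\<close>, which are at most \<open>(T y / b) powr (1 - p')\<close>, are dominated by a
  geometric series. The lower bound is Hoelder's inequality, obtained here by integrating the tangent line inequality for
  \<open>s \<mapsto> s powr (1 - p')\<close> at \<open>s = 1\<close>, applied to \<open>s = x u(t) / W x\<close>.
\<close>

section \<open>Conjugate exponents and a tangent line inequality\<close>

lemma conjugate_exponents:
  fixes p p' :: real
  assumes p: "1 < p" and conj: "1 / p + 1 / p' = 1"
  shows "1 < p'" "(p - 1) * (p' - 1) = 1" "p * (p' - 1) = p'" "(1 - p') / p' = - 1 / p"
proof -
  have "p' \<noteq> 0" using conj p by auto
  then have eq: "p' + p = p * p'" using conj p by (auto simp: field_simps)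
  then have "(p - 1) * (p' - 1) = 1" by (auto simp: algebra_simps)
  then show "(p - 1) * (p' - 1) = 1" .
  then have "p' - 1 = 1 / (p - 1)" using p by (simp add: field_simps)
  then show "1 < p'" using p by (smt (verit) divide_pos_pos)
  show "p * (p' - 1) = p'" using eq by (auto simp: algebra_simps)
  show "(1 - p') / p' = - 1 / p" using eq p \<open>p' \<noteq> 0\<close> by (auto simp: field_simps)
qed

text \<open>With \<open>z = (1 - p') * ln s\<close> this combines \<open>exp z \<ge> 1 + z\<close>
  with \<open>ln s \<le> s - 1\<close>, the latter multiplied by \<open>p' - 1 > 0\<close>.\<close>

lemma powr_tangent_line:
  fixes p' s :: real
  assumes "1 < p'" "0 < s"
  shows "p' \<le> s powr (1 - p') + (p' - 1) * s"
proof -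
  have "1 + (1 - p') * ln s \<le> s powr (1 - p')"
    using exp_ge_add_one_self[of "(1 - p') * ln s"] assms by (simp add: powr_def)
  moreover have "(p' - 1) * ln s \<le> (p' - 1) * (s - 1)"
    using ln_le_minus_one[OF assms(2)] assms(1) by (intro mult_left_mono) auto
  ultimately show ?thesis by (simp add: algebra_simps)
qed

text \<open>The case of finite positive weights. Since \<open>W\<close> and \<open>T\<close> are
  real-valued, the assumed equations also record that both integrals are finite. Nothing is said
  about \<open>u\<close> at non-positive arguments.\<close>

locale increasing_B_weight =
  fixes p p' b :: real and u W T :: "real \<Rightarrow> real"
  assumes p: "1 < p" and conj: "1 / p + 1 / p' = 1"
    and u_pos: "0 < t \<Longrightarrow> 0 < u t" and mono: "mono_on {0<..} u"
    and W: "0 < y \<Longrightarrow> (\<integral>\<^sup>+t\<in>{0<..<y}. ennreal (u t) \<partial>lborel) = ennreal (W y)"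
    and W_nonneg: "0 < y \<Longrightarrow> 0 \<le> W y"
    and T: "0 < y \<Longrightarrow> (\<integral>\<^sup>+t\<in>{y<..}. ennreal (u t / t powr p) \<partial>lborel) = ennreal (T y)"
    and T_nonneg: "0 < y \<Longrightarrow> 0 \<le> T y"
    and B: "0 < y \<Longrightarrow> y powr p * T y \<le> b * W y"
begin

section \<open>Measurability and elementary bounds for \<open>W\<close> and \<open>T\<close>\<close>

lemma u_mono: "0 < s \<Longrightarrow> s \<le> t \<Longrightarrow> u s \<le> u t"
  using mono by (auto simp: mono_on_def)

lemma u_measurable: "u \<in> borel_measurable (restrict_space borel {0<..})"
  by (rule borel_measurable_mono_on_fnc[OF mono])

text \<open>Monotonicity makes \<open>u\<close> measurable on the positive half-line only, so the
  integrands have to be handled as products with an indicator.\<close>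

lemma u_indicator_measurable:
  assumes "A \<subseteq> {0<..}" "A \<in> sets borel"
  shows "(\<lambda>t. u t * indicator A t) \<in> borel_measurable borel"
proof -
  have "(\<lambda>t. u t * indicator {0<..} t) \<in> borel_measurable borel"
    using u_measurable by (subst (asm) borel_measurable_restrict_space_iff) (auto simp: mult.commute)
  then have "(\<lambda>t. u t * indicator {0<..} t * indicator A t) \<in> borel_measurable borel"
    using assms(2) by measurable
  also have "(\<lambda>t. u t * indicator {0<..} t * indicator A t) = (\<lambda>t. u t * indicator A t)"
    using assms(1) by (auto simp: indicator_def fun_eq_iff)
  finally show ?thesis .
qed

lemmas conj_eqs = conjugate_exponents[OF p conj]

lemma W_le:
  assumes "0 < y" shows "W y \<le> y * u y"
proof -
  have "ennreal (W y) \<le> (\<integral>\<^sup>+t. ennreal (u y) * indicator {0<..<y} t \<partial>lborel)"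
    unfolding W[OF assms, symmetric]
    by (intro nn_integral_mono) (auto simp: indicator_def intro!: ennreal_leI u_mono)
  also have "\<dots> = ennreal (y * u y)"
    using assms u_pos[OF assms]
    by (subst nn_integral_cmult_indicator) (auto simp: ennreal_mult[symmetric] mult.commute)
  finally show ?thesis using assms u_pos[OF assms] by (simp add: ennreal_le_iff)
qed

lemma W_pos:
  assumes "0 < y" shows "0 < W y"
proof -
  have up: "0 < u (y / 2)" using assms u_pos by simp
  \<comment> \<open>Only the right half of \<open>(0, y)\<close> is kept; there \<open>u\<close> is
    at least \<open>u (y / 2)\<close>.\<close>
  have "ennreal (y / 2 * u (y / 2)) = (\<integral>\<^sup>+t. ennreal (u (y / 2)) * indicator {y/2<..<y} t \<partial>lborel)"
    using assms up
    by (subst nn_integral_cmult_indicator) (auto simp: ennreal_mult[symmetric] mult.commute)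
  also have "\<dots> \<le> ennreal (W y)"
    unfolding W[OF assms, symmetric] using assms
    by (intro nn_integral_mono) (auto simp: indicator_def intro!: ennreal_leI u_mono)
  finally have "y / 2 * u (y / 2) \<le> W y" using W_nonneg[OF assms] by (simp add: ennreal_le_iff)
  moreover have "0 < y / 2 * u (y / 2)" using assms up by simp
  ultimately show ?thesis by linarith
qed

text \<open>On \<open>(y, 2y]\<close>, an interval of length \<open>y\<close>, the numerator is at
  least \<open>u y\<close> and the denominator at most \<open>(2 * y) powr p\<close>.\<close>

lemma T_ge:
  assumes y: "0 < y" shows "T (2 * y) + y * u y / (2 * y) powr p \<le> T y"
proof -
  let ?c = "u y / (2 * y) powr p"
  have c: "0 \<le> ?c" using u_pos[OF y] by simp
  have m: "(\<lambda>t. ennreal (u t / t powr p) * indicator {2 * y<..} t) \<in> borel_measurable lborel"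
  proof -
    have "(\<lambda>t. ennreal (u t * indicator {2 * y<..} t / t powr p)) \<in> borel_measurable lborel"
      using u_indicator_measurable[of "{2*y<..}"] y 
      by (auto intro!: measurable_compose[OF _ measurable_ennreal] borel_measurable_divide)
    also have "(\<lambda>t. ennreal (u t * indicator {2 * y<..} t / t powr p))
        = (\<lambda>t. ennreal (u t / t powr p) * indicator {2 * y<..} t)"
      by (auto simp: indicator_def fun_eq_iff)
    finally show ?thesis .
  qed
  have "ennreal (T (2 * y) + y * u y / (2 * y) powr p) = ennreal (T (2 * y)) + ennreal ?c * ennreal y"
    using y T_nonneg u_pos[OF y] by (simp add: ennreal_plus ennreal_mult[symmetric] mult.commute)
  also have "\<dots> = (\<integral>\<^sup>+t. ennreal (u t / t powr p) * indicator {2 * y<..} t \<partial>lborel)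
      + (\<integral>\<^sup>+t. ennreal ?c * indicator {y<..2 * y} t \<partial>lborel)"
    using y by (simp add: T nn_integral_cmult_indicator)
  also have "\<dots> = (\<integral>\<^sup>+t. ennreal (u t / t powr p) * indicator {2 * y<..} t
      + ennreal ?c * indicator {y<..2 * y} t \<partial>lborel)"
    by (rule nn_integral_add[symmetric, OF m]) auto
  also have "\<dots> \<le> ennreal (T y)"
    unfolding T[OF y, symmetric] using y p u_pos[OF y]
    by (intro nn_integral_mono)
       (auto simp: indicator_def intro!: ennreal_leI frac_le u_mono powr_mono2 less_imp_le[OF u_pos])
  finally show ?thesis using T_nonneg[OF y] by (simp add: ennreal_le_iff)
qed

lemma T_pos:
  assumes "0 < y" shows "0 < T y"
proof -
  have "0 < y * u y / (2 * y) powr p" using assms u_pos[OF assms] by simp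
  then show ?thesis using T_ge[OF assms] T_nonneg[of "2 * y"] assms by linarith
qed

section \<open>Geometric decay of \<open>T\<close> under doubling\<close>

lemma b_pos: "0 < b"
proof -
  have "0 < b * W 1" using B[of 1] T_pos[of 1] by simp
  then show ?thesis using W_pos[of 1] by (simp add: zero_less_mult_iff)
qed

lemma T_le:
  assumes y: "0 < y" shows "T y \<le> b * (y powr (1 - p) * u y)"
proof -
  have "y powr p * T y \<le> b * (y * u y)"
    using B[OF y] mult_left_mono[OF W_le[OF y], of b] b_pos by linarith
  then have "T y \<le> b * (y * u y) / y powr p" using y by (simp add: field_simps)
  also have "\<dots> = b * (y powr (1 - p) * u y)" using y by (simp add: powr_diff)
  finally show ?thesis .
qed

text \<open>By \<open>T_le\<close>, the amount that \<open>T_ge\<close> removes in passing from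
  \<open>y\<close> to \<open>2 * y\<close> is at least the fraction
  \<open>1 / (2 powr p * b)\<close> of \<open>T y\<close>; at most the fraction \<open>q\<close>
  remains.\<close>

definition q :: real where "q = 1 - 1 / (2 powr p * b)"

lemma T_double:
  assumes y: "0 < y" shows "T (2 * y) \<le> q * T y"
proof -
  have "T y / (2 powr p * b) \<le> y * u y / (2 * y) powr p"
    using T_le[OF y] y b_pos by (simp add: powr_mult powr_diff field_simps)
  then show ?thesis using T_ge[OF y] by (simp add: q_def algebra_simps)
qed

text \<open>Positivity cannot be read off the formula: it comes from
  \<open>0 < T 2 \<le> q * T 1\<close>.\<close>

lemma q: "0 < q" "q < 1"
proof -
  have "0 < q * T 1" using T_double[of 1] T_pos[of 2] by simp
  then show "0 < q" using T_pos[of 1] by (simp add: zero_less_mult_iff)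
  show "q < 1" using b_pos by (simp add: q_def)
qed

lemma T_dyadic:
  assumes "0 < x" shows "T x \<le> q ^ n * T (x / 2 ^ n)"
proof (induction n)
  case (Suc n)
  have "T x \<le> q ^ n * T (2 * (x / 2 ^ Suc n))" using Suc by simp
  also have "\<dots> \<le> q ^ n * (q * T (x / 2 ^ Suc n))"
    using assms q by (intro mult_left_mono T_double) auto
  finally show ?case by (simp add: mult_ac)
qed simp

section \<open>Dyadic upper bound for the dual integral\<close>

definition r :: real where "r = q powr (p' - 1)"

lemma r: "0 < r" "r < 1"
  using q conj_eqs(1) powr_less_mono2[of "p' - 1" q 1] by (auto simp: r_def)

text \<open>For \<open>y = x / 2 ^ n\<close>, \<open>T_le\<close> and \<open>T_dyadic\<close> bound
  \<open>y powr (1 - p) * u y\<close> below by \<open>T x / (b * q ^ n)\<close>. The negative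
  exponent \<open>1 - p'\<close> reverses the inequality and turns \<open>1 / q ^ n\<close> into
  \<open>r ^ n\<close>; since \<open>(1 - p) * (1 - p') = 1\<close>, exactly one factor
  \<open>y\<close> is left.\<close>

lemma dyadic_term:
  assumes x: "0 < x"
  shows "x / 2 ^ n * u (x / 2 ^ n) powr (1 - p') \<le> (T x / b) powr (1 - p') * r ^ n"
proof -
  define y where "y = x / 2 ^ n"
  have y: "0 < y" using x by (simp add: y_def)
  have "T x / (b * q ^ n) \<le> T y / b"
    using T_dyadic[OF x, of n] b_pos q by (simp add: y_def field_simps)
  also have "\<dots> \<le> y powr (1 - p) * u y" using T_le[OF y] b_pos by (simp add: field_simps)
  finally have "(y powr (1 - p) * u y) powr (1 - p') \<le> (T x / b / q ^ n) powr (1 - p')"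
    using conj_eqs(1) T_pos[OF x] b_pos q by (intro powr_mono2') auto
  also have "\<dots> = (T x / b) powr (1 - p') / (q ^ n) powr (1 - p')"
    using T_pos[OF x] b_pos q by (subst powr_divide) auto
  also have "(q ^ n) powr (1 - p') = 1 / r ^ n"
    using q by (simp add: r_def powr_realpow[symmetric] powr_powr powr_minus_divide[symmetric] algebra_simps)
  also have "(y powr (1 - p) * u y) powr (1 - p') = y powr ((1 - p) * (1 - p')) * u y powr (1 - p')"
    using y u_pos[OF y] by (simp add: powr_mult powr_powr)
  also have "(1 - p) * (1 - p') = 1" using conj_eqs(2) by (simp add: algebra_simps)
  finally show ?thesis using y x by (simp add: y_def)
qed

text \<open>The blocks \<open>A n\<close> cover \<open>(0, x)\<close>. As \<open>1 - p' < 0\<close>,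
  the integrand on a block is at most its value \<open>c n\<close> at the left endpoint.\<close>

lemma dual_integral_le:
  assumes x: "0 < x"
  shows "(\<integral>\<^sup>+t\<in>{0<..<x}. ennreal (u t powr (1 - p')) \<partial>lborel)
    \<le> ennreal ((T x / b) powr (1 - p') * (r / (1 - r)))"
proof -
  define A where "A n = {x / 2 ^ Suc n..<x / 2 ^ n}" for n
  define c where "c n = u (x / 2 ^ Suc n) powr (1 - p')" for n
  have "(\<integral>\<^sup>+t\<in>{0<..<x}. ennreal (u t powr (1 - p')) \<partial>lborel)
      \<le> (\<integral>\<^sup>+t. (\<Sum>n. ennreal (c n) * indicator (A n) t) \<partial>lborel)"
  proof (rule nn_integral_mono)
    fix t
    show "ennreal (u t powr (1 - p')) * indicator {0<..<x} t \<le> (\<Sum>n. ennreal (c n) * indicator (A n) t)"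
    proof (cases "0 < t \<and> t < x")
      case True
      have "\<exists>n. x / 2 ^ n \<le> t"
      proof -
        obtain n where "x / t < 2 ^ n" using real_arch_pow[of 2 "x / t"] by auto
        then show ?thesis using True by (intro exI[of _ n]) (simp add: field_simps)
      qed
      \<comment> \<open>The first dyadic point at or below \<open>t\<close>. Its index is not 0
        because \<open>t < x\<close>, and the preceding dyadic point still exceeds \<open>t\<close>,
        so \<open>t\<close> lies in the block with index \<open>n - 1\<close>.\<close>
      define n where "n = (LEAST n. x / 2 ^ n \<le> t)"
      have n: "x / 2 ^ n \<le> t" unfolding n_def by (rule LeastI_ex) fact
      have "n \<noteq> 0" using n True by (intro notI) simp
      then obtain m where m: "n = Suc m" by (cases n) auto
      have "\<not> x / 2 ^ m \<le> t" using not_less_Least[of m "\<lambda>n. x / 2 ^ n \<le> t"] m n_def by simp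
      then have tA: "t \<in> A m" using n m by (simp add: A_def)
      have "u t powr (1 - p') \<le> c m"
        unfolding c_def using tA x conj_eqs(1)
        by (intro powr_mono2' u_mono u_pos) (auto simp: A_def)
      then have "ennreal (u t powr (1 - p')) * indicator {0<..<x} t \<le> ennreal (c m) * indicator (A m) t"
        using True tA by (simp add: ennreal_leI)
      also have "\<dots> = (\<Sum>n\<in>{m}. ennreal (c n) * indicator (A n) t)"
        by (simp del: sum_mult_indicator)
      also have "\<dots> \<le> (\<Sum>n. ennreal (c n) * indicator (A n) t)" by (rule sum_le_suminf) auto
      finally show ?thesis .
    qed (auto simp: indicator_def)
  qed
  also have "\<dots> = (\<Sum>n. ennreal (c n) * emeasure lborel (A n))"
    by (subst nn_integral_suminf) (auto simp: A_def nn_integral_cmult_indicator)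
  \<comment> \<open>The length of \<open>A n\<close> equals its left endpoint
    \<open>x / 2 ^ Suc n\<close>, so \<open>dyadic_term\<close> applies with index
    \<open>Suc n\<close>. The series therefore starts at \<open>r\<close>, which gives
    \<open>r / (1 - r)\<close>.\<close>
  also have "\<dots> = (\<Sum>n. ennreal (x / 2 ^ Suc n * c n))"
    using x by (intro suminf_cong)
      (auto simp: A_def c_def ennreal_mult[symmetric] field_simps)
  also have "\<dots> \<le> (\<Sum>n. ennreal ((T x / b) powr (1 - p') * r ^ Suc n))"
    unfolding c_def by (intro suminf_le ennreal_leI dyadic_term x) auto
  also have "\<dots> = ennreal ((T x / b) powr (1 - p') * (r / (1 - r)))"
  proof (rule suminf_ennreal_eq)
    show "(\<lambda>n. (T x / b) powr (1 - p') * r ^ Suc n) sums ((T x / b) powr (1 - p') * (r / (1 - r)))"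
      using sums_mult[OF geometric_sums[of r], of "(T x / b) powr (1 - p') * r"] r
      by (simp add: mult_ac)
  qed (use r in auto)
  finally show ?thesis .
qed

text \<open>The first two factors come from raising \<open>W x / (2 * x) powr p / b\<close> to the
  power \<open>1 - p'\<close>, using \<open>p * (1 - p') = - p'\<close>; the last is the sum of the
  geometric series.\<close>

definition K :: real where "K = b powr (p' - 1) * 2 powr p' * (r / (1 - r))"

lemma K_nonneg: "0 \<le> K" using r by (simp add: K_def)

text \<open>\<open>T_ge\<close> and \<open>W_le\<close> give
  \<open>T x \<ge> W x / (2 * x) powr p\<close>, which eliminates \<open>T\<close> once the negative
  power has reversed it.\<close>

lemma T_powr_le:
  assumes x: "0 < x"
  shows "(T x / b) powr (1 - p') * (r / (1 - r)) \<le> K * (x powr p' * W x powr (1 - p'))"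
proof -
  have "W x / (2 * x) powr p \<le> x * u x / (2 * x) powr p"
    using W_le[OF x] by (intro divide_right_mono) auto
  also have "\<dots> \<le> T x" using T_ge[OF x] T_nonneg[of "2 * x"] x by simp
  finally have "W x / (2 * x) powr p / b \<le> T x / b" using b_pos by (intro divide_right_mono) auto
  then have "(T x / b) powr (1 - p') \<le> (W x / (2 * x) powr p / b) powr (1 - p')"
    using W_pos[OF x] b_pos x conj_eqs(1) by (intro powr_mono2') auto
  also have "\<dots> = W x powr (1 - p') / ((2 * x) powr (p * (1 - p')) * b powr (1 - p'))"
    using W_pos[OF x] b_pos x by (simp add: powr_divide powr_mult powr_powr mult_ac)
  also have "p * (1 - p') = - p'" using conj_eqs(3) by (simp add: algebra_simps)
  also have "W x powr (1 - p') / ((2 * x) powr (- p') * b powr (1 - p'))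
      = b powr (p' - 1) * 2 powr p' * (x powr p' * W x powr (1 - p'))"
    using x b_pos powr_minus_divide[of b "p' - 1"] by (simp add: powr_minus_divide powr_mult)
  finally have "(T x / b) powr (1 - p') * (r / (1 - r))
      \<le> b powr (p' - 1) * 2 powr p' * (x powr p' * W x powr (1 - p')) * (r / (1 - r))"
    by (rule mult_right_mono) (use r in simp)
  then show ?thesis by (simp only: K_def mult_ac)
qed

lemma dual_integral_upper:
  assumes x: "0 < x"
  shows "(\<integral>\<^sup>+t\<in>{0<..<x}. ennreal (u t powr (1 - p')) \<partial>lborel)
    \<le> ennreal (K * (x powr p' * W x powr (1 - p')))"
  using dual_integral_le[OF x] ennreal_leI[OF T_powr_le[OF x]] by (rule order_trans)

section \<open>Lower bound for the dual integral\<close>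

lemma dual_integral_lower:
  assumes x: "0 < x"
  shows "ennreal (x powr p' * W x powr (1 - p'))
    \<le> (\<integral>\<^sup>+t\<in>{0<..<x}. ennreal (u t powr (1 - p')) \<partial>lborel)" (is "_ \<le> ?S")
proof -
  \<comment> \<open>The upper bound supplies finiteness, so that the final inequality can be
    rearranged in the reals.\<close>
  obtain s where s: "?S = ennreal s" "0 \<le> s"
    using dual_integral_upper[OF x] by (cases ?S) (auto simp: top_unique)
  \<comment> \<open>This scaling makes the integral of \<open>l * u t\<close> over
    \<open>(0, x)\<close> equal to \<open>x\<close>. The linear term of the tangent line then
    integrates to \<open>(p' - 1) * x\<close>, and of \<open>p' * x\<close> on the left exactly
    \<open>x\<close> remains.\<close>
  define l where "l = x / W x"
  have l: "0 < l" using x W_pos[OF x] by (simp add: l_def)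
  have u_x: "(\<lambda>t. u t * indicator {0<..<x} t) \<in> borel_measurable lborel"
    unfolding measurable_lborel2 by (rule u_indicator_measurable) auto
  have m: "(\<lambda>t. ennreal (u t) * indicator {0<..<x} t) \<in> borel_measurable lborel"
  proof -
    have "(\<lambda>t. ennreal (u t * indicator {0<..<x} t)) \<in> borel_measurable lborel"
      using u_x by (auto intro!: measurable_compose[OF _ measurable_ennreal])
    also have "(\<lambda>t. ennreal (u t * indicator {0<..<x} t)) = (\<lambda>t. ennreal (u t) * indicator {0<..<x} t)"
      by (auto simp: indicator_def fun_eq_iff)
    finally show ?thesis .
  qed
  have m': "(\<lambda>t. ennreal (u t powr (1 - p')) * indicator {0<..<x} t) \<in> borel_measurable lborel"
  proof -
    have "(\<lambda>t. ennreal ((u t * indicator {0<..<x} t) powr (1 - p'))) \<in> borel_measurable lborel"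
      using u_x
      by (intro measurable_compose[OF _ measurable_ennreal] powr_real_measurable) auto
    also have "(\<lambda>t. ennreal ((u t * indicator {0<..<x} t) powr (1 - p')))
        = (\<lambda>t. ennreal (u t powr (1 - p')) * indicator {0<..<x} t)"
      by (auto simp: indicator_def fun_eq_iff)
    finally show ?thesis .
  qed
  have "ennreal (p' * x) = (\<integral>\<^sup>+t. ennreal p' * indicator {0<..<x} t \<partial>lborel)"
    using x conj_eqs(1) by (simp add: nn_integral_cmult_indicator ennreal_mult)
  also have "\<dots> \<le> (\<integral>\<^sup>+t. ennreal (l powr (1 - p')) * (ennreal (u t powr (1 - p')) * indicator {0<..<x} t)
      + ennreal ((p' - 1) * l) * (ennreal (u t) * indicator {0<..<x} t) \<partial>lborel)"
  proof (rule nn_integral_mono)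
    fix t
    show "ennreal p' * indicator {0<..<x} t
      \<le> ennreal (l powr (1 - p')) * (ennreal (u t powr (1 - p')) * indicator {0<..<x} t)
      + ennreal ((p' - 1) * l) * (ennreal (u t) * indicator {0<..<x} t)"
    proof (cases "t \<in> {0<..<x}")
      case True
      then have ut: "0 < u t" by (simp add: u_pos)
      have "p' \<le> l powr (1 - p') * u t powr (1 - p') + (p' - 1) * l * u t"
        using powr_tangent_line[OF conj_eqs(1), of "l * u t"] l ut by (simp add: powr_mult mult_ac)
      then have "ennreal p' \<le> ennreal (l powr (1 - p') * u t powr (1 - p') + (p' - 1) * l * u t)"
        by (rule ennreal_leI)
      then show ?thesis using True l ut conj_eqs(1) by (simp add: ennreal_plus ennreal_mult)
    qed simp
  qed
  also have "\<dots> = ennreal (l powr (1 - p')) * ?S + ennreal ((p' - 1) * l) * ennreal (W x)"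
    using m m' x by (simp add: nn_integral_add nn_integral_cmult W)
  also have "\<dots> = ennreal (l powr (1 - p') * s + (p' - 1) * l * W x)"
    using s l conj_eqs(1) W_pos[OF x] by (simp add: ennreal_plus ennreal_mult)
  finally have "p' * x \<le> l powr (1 - p') * s + (p' - 1) * l * W x"
    using s l conj_eqs(1) W_pos[OF x] by (subst (asm) ennreal_le_iff) auto
  moreover have "(p' - 1) * l * W x = p' * x - x"
    using W_pos[OF x] by (simp add: l_def field_simps)
  ultimately have "x \<le> l powr (1 - p') * s" by simp
  then have "x * l powr (p' - 1) \<le> s"
    using l powr_minus_divide[of l "p' - 1"] by (simp add: pos_le_divide_eq)
  moreover have "x * l powr (p' - 1) = x powr p' * W x powr (1 - p')"
    using x W_pos[OF x] powr_minus_divide[of "W x" "p' - 1"]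
    by (simp add: l_def powr_divide powr_diff)
  ultimately show ?thesis using s by (simp add: ennreal_leI)
qed

section \<open>Passing to roots of order \<open>p'\<close>\<close>

lemma dual_integral_powr:
  assumes x: "0 < x"
  defines "S \<equiv> \<integral>\<^sup>+t\<in>{0<..<x}. ennreal (u t powr (1 - p')) \<partial>lborel"
  shows "ennreal (x * W x powr (- 1 / p)) \<le> ennreal_rpow S (1 / p')"
    and "ennreal_rpow S (1 / p') \<le> ennreal (K powr (1 / p')) * ennreal (x * W x powr (- 1 / p))"
proof -
  let ?E = "x powr p' * W x powr (1 - p')"
  have E: "0 < ?E" using x W_pos[OF x] by simp
  have upper: "S \<le> ennreal (K * ?E)" and lower: "ennreal ?E \<le> S"
    unfolding S_def using dual_integral_upper[OF x] dual_integral_lower[OF x] .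
  then obtain s where s: "S = ennreal s" "0 \<le> s" by (cases S) (auto simp: top_unique)
  have s_bounds: "?E \<le> s" "s \<le> K * ?E"
    using upper lower s E K_nonneg by (auto simp: ennreal_le_iff ennreal_le_iff2)
  \<comment> \<open>The bounds force \<open>0 < s\<close>, so neither convention for 0 nor for
    \<infinity> applies.\<close>
  have rpow: "ennreal_rpow S (1 / p') = ennreal (s powr (1 / p'))"
    using s s_bounds(1) E conj_eqs(1) by (auto simp: ennreal_rpow_def)
  \<comment> \<open>The exponent of \<open>W x\<close> becomes
    \<open>(1 - p') / p' = - 1 / p\<close>.\<close>
  have root: "?E powr (1 / p') = x * W x powr (- 1 / p)"
    using x W_pos[OF x] conj_eqs(1,4) by (simp add: powr_mult powr_powr)
  show "ennreal (x * W x powr (- 1 / p)) \<le> ennreal_rpow S (1 / p')"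
    unfolding rpow root[symmetric] using s_bounds E conj_eqs(1)
    by (intro ennreal_leI powr_mono2) auto
  have "s powr (1 / p') \<le> (K * ?E) powr (1 / p')"
    using s_bounds s conj_eqs(1) by (intro powr_mono2) auto
  also have "\<dots> = K powr (1 / p') * (x * W x powr (- 1 / p))"
    unfolding root[symmetric] by (rule powr_mult)
  finally show "ennreal_rpow S (1 / p') \<le> ennreal (K powr (1 / p')) * ennreal (x * W x powr (- 1 / p))"
    unfolding rpow using x by (simp add: ennreal_mult[symmetric] ennreal_leI)
qed

end

section \<open>Weights that take the value 0 or \<infinity>\<close>

lemma nn_integral_mono_on_le:
  fixes w :: "real \<Rightarrow> ennreal"
  assumes "mono_on {0<..} w" "0 < y"
  shows "(\<integral>\<^sup>+t\<in>{0<..<y}. w t \<partial>lborel) \<le> w y * ennreal y"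
proof -
  have "(\<integral>\<^sup>+t\<in>{0<..<y}. w t \<partial>lborel) \<le> (\<integral>\<^sup>+t. w y * indicator {0<..<y} t \<partial>lborel)"
    using assms by (intro nn_integral_mono) (auto simp: indicator_def mono_on_def)
  also have "\<dots> = w y * ennreal y"
    using assms by (simp add: nn_integral_cmult_indicator)
  finally show ?thesis .
qed

text \<open>The interval \<open>(m, 2m]\<close> lies beyond both \<open>a\<close> and
  \<open>y\<close>, so a single value of \<open>w\<close> bounds every tail from below. This is how
  a value 0 or \<infinity> spreads to the whole half-line.\<close>

lemma nn_integral_tail_ge:
  fixes w :: "real \<Rightarrow> ennreal"
  assumes w: "mono_on {0<..} w" and "0 < y" "y \<le> m" "a \<le> m" "0 < p"
  shows "w y / ennreal ((2 * m) powr p) * ennreal m \<le> (\<integral>\<^sup>+t\<in>{a<..}. (w t / ennreal (t powr p)) \<partial>lborel)"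
proof -
  have "w y / ennreal ((2 * m) powr p) * ennreal m
      = (\<integral>\<^sup>+t. w y / ennreal ((2 * m) powr p) * indicator {m<..2 * m} t \<partial>lborel)"
    using assms by (subst nn_integral_cmult_indicator) auto
  also have "\<dots> \<le> (\<integral>\<^sup>+t\<in>{a<..}. (w t / ennreal (t powr p)) \<partial>lborel)"
  proof (intro nn_integral_mono)
    fix t
    show "w y / ennreal ((2 * m) powr p) * indicator {m<..2 * m} t
        \<le> w t / ennreal (t powr p) * indicator {a<..} t"
    proof (cases "t \<in> {m<..2 * m}")
      case True
      have "inverse (ennreal ((2 * m) powr p)) \<le> inverse (ennreal (t powr p))"
        using assms True
        by (simp add: inverse_ennreal) (intro ennreal_leI le_imp_inverse_le powr_mono2; auto)
      moreover have "w y \<le> w t" using assms True by (auto simp: mono_on_def)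
      ultimately have "w y / ennreal ((2 * m) powr p) \<le> w t / ennreal (t powr p)"
        unfolding divide_ennreal_def by (intro mult_mono) auto
      then show ?thesis using True assms by simp
    qed simp
  qed
  finally show ?thesis .
qed

text \<open>If \<open>w a = 0\<close>, monotonicity makes the integral over \<open>(0, a)\<close>
  vanish, hence by the class condition also the tail beyond \<open>a\<close>. Taking
  \<open>m = max a y\<close> in the tail bound treats \<open>y\<close> on either side of
  \<open>a\<close>.\<close>

lemma B_class_zero:
  assumes w: "w \<in> B_class p" "mono_on {0<..} w" and "0 < p" "0 < a" "w a = 0" "0 < y"
  shows "w y = 0"
proof -
  obtain \<beta> where \<beta>: "ennreal (a powr p) * (\<integral>\<^sup>+t\<in>{a<..}. (w t / ennreal (t powr p)) \<partial>lborel)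
      \<le> \<beta> * (\<integral>\<^sup>+t\<in>{0<..<a}. w t \<partial>lborel)"
    using w(1) \<open>0 < a\<close> by (auto simp: B_class_def)
  have "(\<integral>\<^sup>+t\<in>{0<..<a}. w t \<partial>lborel) = 0"
    using nn_integral_mono_on_le[OF w(2) \<open>0 < a\<close>] \<open>w a = 0\<close> by simp
  then have "(\<integral>\<^sup>+t\<in>{a<..}. (w t / ennreal (t powr p)) \<partial>lborel) = 0"
    using \<beta> \<open>0 < a\<close> by (simp del: nn_integral_0_iff)
  then have "w y / ennreal ((2 * max a y) powr p) * ennreal (max a y) = 0"
    using nn_integral_tail_ge[OF w(2) \<open>0 < y\<close>, of "max a y" a p] \<open>0 < p\<close> by simp
  then show ?thesis using \<open>0 < a\<close> by (auto simp: divide_ennreal_def ennreal_eq_0_iff max_def split: if_splits)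
qed

text \<open>An infinite value makes every tail infinite. Since \<beta> is finite, the integral over
  \<open>(0, y)\<close> must be infinite too, and it is at most
  \<open>w y * ennreal y\<close>.\<close>

lemma B_class_top:
  assumes w: "w \<in> B_class p" "mono_on {0<..} w" and "0 < p" "0 < a" "w a = \<infinity>" "0 < y"
  shows "(\<integral>\<^sup>+t\<in>{0<..<y}. w t \<partial>lborel) = \<infinity>" and "w y = \<infinity>"
proof -
  obtain \<beta> where \<beta>: "\<beta> < \<infinity>" "ennreal (y powr p) * (\<integral>\<^sup>+t\<in>{y<..}. (w t / ennreal (t powr p)) \<partial>lborel)
      \<le> \<beta> * (\<integral>\<^sup>+t\<in>{0<..<y}. w t \<partial>lborel)"
    using w(1) \<open>0 < y\<close> by (auto simp: B_class_def)
  have "w a / ennreal ((2 * max a y) powr p) * ennreal (max a y) = \<infinity>"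
    using \<open>w a = \<infinity>\<close> \<open>0 < a\<close> by (simp add: ennreal_top_divide ennreal_top_mult max_def)
  then have "(\<integral>\<^sup>+t\<in>{y<..}. (w t / ennreal (t powr p)) \<partial>lborel) = \<infinity>"
    using nn_integral_tail_ge[OF w(2) \<open>0 < a\<close>, of "max a y" y p] \<open>0 < p\<close> by (simp add: top_unique)
  then show *: "(\<integral>\<^sup>+t\<in>{0<..<y}. w t \<partial>lborel) = \<infinity>"
    using \<beta> \<open>0 < y\<close> by (auto simp: ennreal_mult_top top_unique ennreal_mult_eq_top_iff)
  show "w y = \<infinity>"
    using nn_integral_mono_on_le[OF w(2) \<open>0 < y\<close>] * by (auto simp: top_unique ennreal_mult_eq_top_iff)
qed

section \<open>The three cases and the final constant\<close>

theorem lemma4p1: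
  fixes p p' :: real and w :: "real \<Rightarrow> ennreal"
  assumes "1 < p" and "1 / p + 1 / p' = 1"
    and "w \<in> B_class p" and "mono_on {0<..} w"
  shows "\<exists>C\<^sub>6::ennreal. C\<^sub>6 < \<infinity> \<and> (\<forall>x>0.
      ennreal x * ennreal_rpow (\<integral>\<^sup>+t\<in>{0<..<x}. w t \<partial>lborel) (- 1 / p)
        \<le> ennreal_rpow (\<integral>\<^sup>+t\<in>{0<..<x}. ennreal_rpow (w t) (1 - p') \<partial>lborel) (1 / p') \<and>
      ennreal_rpow (\<integral>\<^sup>+t\<in>{0<..<x}. ennreal_rpow (w t) (1 - p') \<partial>lborel) (1 / p')
        \<le> C\<^sub>6 * (ennreal x * ennreal_rpow (\<integral>\<^sup>+t\<in>{0<..<x}. w t \<partial>lborel) (- 1 / p)))"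
proof -
  have pos: "0 < p" "1 < p'" using assms(1) conjugate_exponents(1)[OF assms(1,2)] by auto
  consider (zero) a where "0 < a" "w a = 0" | (top) a where "0 < a" "w a = \<infinity>"
    | (regular) "\<And>a. 0 < a \<Longrightarrow> 0 < w a \<and> w a < \<infinity>"
    by (metis ennreal_zero_neq_top infinity_ennreal_def not_gr_zero top.not_eq_extremum)
  then show ?thesis
  proof cases
    case zero
    have w: "w y = 0" if "0 < y" for y
      using B_class_zero[OF assms(3,4) pos(1) zero that] .
    have "(\<integral>\<^sup>+t\<in>{0<..<x}. w t \<partial>lborel) = (\<integral>\<^sup>+t. 0 \<partial>(lborel :: real measure))" for x :: real
      by (intro nn_integral_cong) (auto simp: indicator_def w)
    then have W: "(\<integral>\<^sup>+t\<in>{0<..<x}. w t \<partial>lborel) = 0" for x :: real by simp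
    have eq: "(\<integral>\<^sup>+t\<in>{0<..<x}. ennreal_rpow (w t) (1 - p') \<partial>lborel)
        = (\<integral>\<^sup>+t. \<infinity> * indicator {0<..<x} t \<partial>lborel)" for x :: real
      using pos by (intro nn_integral_cong) (auto simp: indicator_def w ennreal_rpow_def)
    have S: "(\<integral>\<^sup>+t\<in>{0<..<x}. ennreal_rpow (w t) (1 - p') \<partial>lborel) = \<infinity>" if "0 < x" for x
      unfolding eq using that by (subst nn_integral_cmult_indicator) (auto simp: ennreal_top_mult)
    \<comment> \<open>For \<open>w = 0\<close> all compared quantities are \<infinity>, so the
      constant 1 serves.\<close>
    have "ennreal_rpow 0 (- 1 / p) = \<infinity>" "ennreal_rpow \<infinity> (1 / p') = \<infinity>"
      using pos by (auto simp: ennreal_rpow_def)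
    then show ?thesis
      using pos by (intro exI[of _ 1]) (auto simp: W S ennreal_mult_top)
  next
    case top
    have W: "(\<integral>\<^sup>+t\<in>{0<..<x}. w t \<partial>lborel) = \<infinity>" if "0 < x" for x
      using B_class_top(1)[OF assms(3,4) pos(1) top that] .
    have "(\<integral>\<^sup>+t\<in>{0<..<x}. ennreal_rpow (w t) (1 - p') \<partial>lborel) = (\<integral>\<^sup>+t. 0 \<partial>(lborel :: real measure))" for x :: real
      using pos B_class_top(2)[OF assms(3,4) pos(1) top]
      by (intro nn_integral_cong) (auto simp: indicator_def ennreal_rpow_def)
    then have S: "(\<integral>\<^sup>+t\<in>{0<..<x}. ennreal_rpow (w t) (1 - p') \<partial>lborel) = 0" for x :: real by simp
    \<comment> \<open>For \<open>w = \<infinity>\<close> all compared quantities are 0, and 1 serves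
      again.\<close>
    have "ennreal_rpow \<infinity> (- 1 / p) = 0" "ennreal_rpow 0 (1 / p') = 0"
      using pos by (auto simp: ennreal_rpow_def)
    then show ?thesis
      using pos by (intro exI[of _ 1]) (auto simp: W S)
  next
    case regular
    define u where "u t = enn2real (w t)" for t
    have wu: "w t = ennreal (u t)" and u_pos: "0 < u t" if "0 < t" for t
      using regular[OF that] by (auto simp: u_def enn2real_positive_iff less_top)
    obtain \<beta> where \<beta>: "\<beta> < \<infinity>" "\<And>y. 0 < y \<Longrightarrow> ennreal (y powr p) *
        (\<integral>\<^sup>+t\<in>{y<..}. (w t / ennreal (t powr p)) \<partial>lborel) \<le> \<beta> * (\<integral>\<^sup>+t\<in>{0<..<y}. w t \<partial>lborel)"
      using assms(3) by (auto simp: B_class_def)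
    obtain b where b: "\<beta> = ennreal b" "0 \<le> b" using \<beta>(1) by (cases \<beta>) auto
    define W where "W y = enn2real (\<integral>\<^sup>+t\<in>{0<..<y}. w t \<partial>lborel)" for y
    define T where "T y = enn2real (\<integral>\<^sup>+t\<in>{y<..}. (w t / ennreal (t powr p)) \<partial>lborel)" for y
    have int_W: "(\<integral>\<^sup>+t\<in>{0<..<y}. w t \<partial>lborel) = ennreal (W y)" if "0 < y" for y
    proof -
      have "(\<integral>\<^sup>+t\<in>{0<..<y}. w t \<partial>lborel) \<le> ennreal (u y) * ennreal y"
        using nn_integral_mono_on_le[OF assms(4) that] wu[OF that] by simp
      also have "\<dots> < \<infinity>" by (simp add: ennreal_mult_less_top)
      finally show ?thesis by (simp add: W_def)
    qed
    \<comment> \<open>Finiteness of the tail is not a matter of monotonicity: it follows from the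
      class condition, the integral over \<open>(0, y)\<close> and \<beta> being finite.\<close>
    have int_T: "(\<integral>\<^sup>+t\<in>{y<..}. (w t / ennreal (t powr p)) \<partial>lborel) = ennreal (T y)" if "0 < y" for y
    proof -
      have "ennreal (y powr p) * (\<integral>\<^sup>+t\<in>{y<..}. (w t / ennreal (t powr p)) \<partial>lborel) < \<infinity>"
        using \<beta>(2)[OF that] unfolding int_W[OF that] b(1)
        by (rule order_le_less_trans) (simp add: ennreal_mult_less_top)
      then show ?thesis using that by (auto simp: T_def ennreal_mult_less_top)
    qed
    have nonneg: "0 \<le> W y" "0 \<le> T y" for y by (simp_all add: W_def T_def)
    interpret increasing_B_weight p p' b u W T
    proof
      show "mono_on {0<..} u"
        using assms(4) regular by (auto simp: mono_on_def u_def intro!: enn2real_mono)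
      show "(\<integral>\<^sup>+t\<in>{0<..<y}. ennreal (u t) \<partial>lborel) = ennreal (W y)" if "0 < y" for y
        unfolding int_W[OF that, symmetric] by (intro nn_integral_cong) (auto simp: indicator_def wu)
      show "(\<integral>\<^sup>+t\<in>{y<..}. ennreal (u t / t powr p) \<partial>lborel) = ennreal (T y)" if "0 < y" for y
        unfolding int_T[OF that, symmetric] using that u_pos
        by (intro nn_integral_cong) (auto simp: indicator_def wu divide_ennreal less_imp_le)
      show "y powr p * T y \<le> b * W y" if "0 < y" for y
        using \<beta>(2)[OF that] b(2)
        by (simp add: int_W[OF that] int_T[OF that] b(1) ennreal_mult[symmetric] nonneg)
    qed (use assms u_pos nonneg in auto)
    have S: "(\<integral>\<^sup>+t\<in>{0<..<x}. ennreal_rpow (w t) (1 - p') \<partial>lborel)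
        = (\<integral>\<^sup>+t\<in>{0<..<x}. ennreal (u t powr (1 - p')) \<partial>lborel)" for x
      using pos u_pos
      by (intro nn_integral_cong) (auto simp: indicator_def wu ennreal_rpow_def ennreal_eq_0_iff not_le less_imp_le)
    have R: "ennreal x * ennreal_rpow (\<integral>\<^sup>+t\<in>{0<..<x}. w t \<partial>lborel) (- 1 / p)
        = ennreal (x * W x powr (- 1 / p))" if "0 < x" for x
      unfolding int_W[OF that] using pos that W_pos[OF that]
      by (auto simp: ennreal_rpow_def ennreal_eq_0_iff ennreal_mult)
    show ?thesis
      by (intro exI[of _ "ennreal (K powr (1 / p'))"] conjI allI impI)
         (simp_all only: S R dual_integral_powr ennreal_less_top infinity_ennreal_def)
  qed
qed

end
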